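(* Let $r>1$, let $\alpha$ be a real number that is Diophantine of type $r$, and let $g:\mathbb{R}\to\mathbb{C}$ be a $1$-periodic function of bounded variation with $\int_0^1 g(x)\,dx=0$. Then the Dirichlet series $$ \zeta_{g,\alpha}(s)=\sum_{n=1}^{\infty}\frac{g(n\alpha)}{n^s} $$ has an abscissa of convergence $\sigma_0\le 1-\frac1r$.
   Context: A real number $\alpha$ is Diophantine of type $r$ (where $r>1$) if there exists $C>0$ such that $|\alpha-\frac{p}{q}|\ge \frac{C}{q^{1+r}}$ for all rational numbers $p/q$ (with $q\geq 1$). The variation of a $1$-periodic function $g$ is $\sup_P\sum_i|g(x_{i+1})-g(x_i)|$, the supremum being over all partitions $P=\{x_1<\dots<x_n\}$ of $[0,1]$; $g$ is of bounded variation if this is finite. The abscissa of convergence of a Dirichlet series $\sum_{n\ge1} a_n n^{-s}$ is the number $\sigma_0\in[-\infty,\infty]$ such that the series converges for $\mathrm{Re}(s)>\sigma_0$ and diverges for $\mathrm{Re}(s)<\sigma_0$. *)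

theory Defs
  imports "HOL-Analysis.Analysis"
begin

(* Fractions p/q are not required to be in lowest terms; a reducible p/q only gives a
   weaker inequality than its reduced form. *)
definition diophantine_of_type :: "real \<Rightarrow> real \<Rightarrow> bool" where
  "diophantine_of_type r \<alpha> \<longleftrightarrow>
     (\<exists>C>0. \<forall>(p::int) (q::nat). q \<ge> 1 \<longrightarrow>
        \<bar>\<alpha> - real_of_int p / real q\<bar> \<ge> C / real q powr (1 + r))"

(* Total variation over one period; partitions 0 = x 0 < ... < x n = 1 are indexed from 0,
   and only the values of x on {..n} matter. *)
definition variation :: "(real \<Rightarrow> complex) \<Rightarrow> ennreal" where
  "variation g =
     (SUP (n, x) \<in> {(n::nat, x::nat \<Rightarrow> real). x 0 = 0 \<and> x n = 1 \<and> strict_mono_on {..n} x}.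
        \<Sum>i<n. ennreal (norm (g (x (Suc i)) - g (x i))))"

definition bounded_variation :: "(real \<Rightarrow> complex) \<Rightarrow> bool" where
  "bounded_variation g \<longleftrightarrow> variation g < \<infinity>"

(* Convergence of the sum of a n / n^s over n >= 1, in the sense of (possibly conditional)
   convergence of partial sums; a 0 plays no role. *)
definition dirichlet_converges :: "(nat \<Rightarrow> complex) \<Rightarrow> complex \<Rightarrow> bool" where
  "dirichlet_converges a s \<longleftrightarrow> summable (\<lambda>n. a (Suc n) / of_nat (Suc n) powr s)"

definition is_abscissa_of_convergence :: "(nat \<Rightarrow> complex) \<Rightarrow> ereal \<Rightarrow> bool" where
  "is_abscissa_of_convergence a \<sigma>\<^sub>0 \<longleftrightarrow>
     (\<forall>s. ereal (Re s) > \<sigma>\<^sub>0 \<longrightarrow> dirichlet_converges a s) \<and>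
     (\<forall>s. ereal (Re s) < \<sigma>\<^sub>0 \<longrightarrow> \<not> dirichlet_converges a s)"

definition zeta_coeff :: "(real \<Rightarrow> complex) \<Rightarrow> real \<Rightarrow> nat \<Rightarrow> complex" where
  "zeta_coeff g \<alpha> n = g (real n * \<alpha>)"

end

theory Submission
  imports Defs
begin

text \<open>If \<open>\<bar>k \<alpha> - h\<bar> \<le> 1/k\<close> with \<open>h\<close>, \<open>k\<close> coprime, then \<open>k\<close> consecutive points \<open>x + n \<alpha>\<close> of the
  orbit are within \<open>1/k\<close> of \<open>k\<close> equidistant points of the circle. Averaging over the position of
  the equidistant points, over which \<open>g\<close> has mean 0, shows that the sum of \<open>g\<close> over the orbit
  points is at most twice the variation (Denjoy-Koksma). By Dirichlet's theorem such a \<open>k \<le> N\<close> exists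
  with \<open>\<bar>k \<alpha> - h\<bar> < 1/N\<close>, and the Diophantine condition then forces \<open>k\<close> to be at least a constant
  times \<open>N powr (1/r)\<close>. Cutting the first \<open>N\<close> orbit points into \<open>N div k\<close> blocks of length \<open>k\<close> and a
  remainder of length \<open>N mod k \<le> N/2\<close>, induction yields partial sums of order \<open>N powr (1 - 1/r)\<close>
  without a logarithmic loss, and Abel summation concludes.\<close>

section \<open>Partition sums and a monotone majorant for the increments of \<open>g\<close>\<close>

lemma sum_le_variation:
  assumes "x 0 = 0" "x n = 1" "strict_mono_on {..n} x" "variation g < \<infinity>"
  shows "(\<Sum>i<n. norm (g (x (Suc i)) - g (x i))) \<le> enn2real (variation g)"
proof -
  have "(\<Sum>i<n. ennreal (norm (g (x (Suc i)) - g (x i)))) \<le> variation g"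
    unfolding variation_def by (rule SUP_upper2[of "(n, x)"]) (use assms in auto)
  then have "ennreal (\<Sum>i<n. norm (g (x (Suc i)) - g (x i))) \<le> variation g"
    by (simp add: sum_ennreal)
  then show ?thesis
    using assms(4) enn2real_mono[of _ "variation g"] by (fastforce simp: sum_nonneg)
qed

text \<open>For 0 \<le> \<open>b\<close> \<le> 1 the supremum of this set is the variation of
  \<open>g\<close> on [0, \<open>b\<close>]. Plain reals are used so that increments can be
  subtracted once boundedness is known.\<close>

definition variation_sums :: "(real \<Rightarrow> complex) \<Rightarrow> real \<Rightarrow> real set" where
  "variation_sums g b = {\<Sum>i<n. norm (g (x (Suc i)) - g (x i)) | n x.
     x 0 = 0 \<and> x n = b \<and> strict_mono_on {..n} x}"

text \<open>Append \<open>b\<close> as a new last node. This yields both the boundedness of all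
  partition sums and the superadditivity of the variation function.\<close>

lemma variation_sums_extend:
  assumes "S \<in> variation_sums g a" "a < b"
  shows "S + norm (g b - g a) \<in> variation_sums g b"
proof -
  obtain n x where S: "S = (\<Sum>i<n. norm (g (x (Suc i)) - g (x i)))"
    and x: "x 0 = 0" "x n = a" "strict_mono_on {..n} x"
    using assms(1) by (auto simp: variation_sums_def)
  define y where "y = x(Suc n := b)"
  have le: "x i \<le> a" if "i \<le> n" for i
    using strict_mono_on_leD[OF x(3), of i n] that x(2) by auto
  have "strict_mono_on {..Suc n} y"
    by (rule strict_mono_onI)
       (use x(3) le assms(2) in \<open>auto simp: y_def le_Suc_eq strict_mono_on_def dest: le less_le_trans le_less_trans\<close>)
  moreover have "S + norm (g b - g a) = (\<Sum>i<Suc n. norm (g (y (Suc i)) - g (y i)))"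
    using x by (simp add: S y_def)
  ultimately show ?thesis
    using x(1) unfolding variation_sums_def
    by (intro CollectI exI[of _ "Suc n"] exI[of _ y]) (auto simp: y_def)
qed

lemma variation_sums_0: "0 \<in> variation_sums g 0"
  unfolding variation_sums_def
  by (intro CollectI exI[of _ 0] exI[of _ "\<lambda>_. 0"]) (auto simp: strict_mono_on_def)

text \<open>\<open>T b\<close> is the variation of \<open>g\<close> on [0, \<open>b\<close>]. It is
  finite because a partition of [0, \<open>b\<close>] extends to one of [0, 1], and extending
  partitions from \<open>a\<close> to \<open>b\<close> raises it by at least the increment of
  \<open>g\<close>.\<close>

lemma variation_majorant_unit_interval:
  assumes "bounded_variation g"
  obtains T :: "real \<Rightarrow> real" where
    "\<And>a b. \<lbrakk>0 \<le> a; a \<le> b; b \<le> 1\<rbrakk> \<Longrightarrow> norm (g b - g a) \<le> T b - T a"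
proof -
  define V where "V = enn2real (variation g)"
  have fin: "variation g < \<infinity>"
    using assms by (simp add: bounded_variation_def)
  have le1: "S \<le> V" if "S \<in> variation_sums g 1" for S
    using that sum_le_variation[OF _ _ _ fin] by (auto simp: variation_sums_def V_def)
  have le: "S \<le> V" if "S \<in> variation_sums g b" "b \<le> 1" for S b
  proof (cases "b = 1")
    case False
    then have "S + norm (g 1 - g b) \<le> V"
      using le1 variation_sums_extend[OF that(1), of 1] that(2) by simp
    then show ?thesis using norm_ge_zero[of "g 1 - g b"] by linarith
  qed (use that le1 in simp)
  have bdd: "bdd_above (variation_sums g b)" if "b \<le> 1" for b
    using le that by (auto simp: bdd_above_def)
  have ne: "variation_sums g b \<noteq> {}" if "0 \<le> b" for b
    using variation_sums_0[of g] variation_sums_extend[OF variation_sums_0[of g], of b] that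
    by (cases "b = 0") auto
  show thesis
  proof (rule that[of "\<lambda>b. Sup (variation_sums g b)"])
    fix a b :: real
    assume ab: "0 \<le> a" "a \<le> b" "b \<le> 1"
    show "norm (g b - g a) \<le> Sup (variation_sums g b) - Sup (variation_sums g a)"
    proof (cases "a = b")
      case False
      have "Sup (variation_sums g a) \<le> Sup (variation_sums g b) - norm (g b - g a)"
      proof (rule cSup_least)
        show "variation_sums g a \<noteq> {}" using ne ab by simp
        fix S assume "S \<in> variation_sums g a"
        then have "S + norm (g b - g a) \<le> Sup (variation_sums g b)"
          using variation_sums_extend[of S g a b] bdd ab False by (intro cSup_upper) auto
        then show "S \<le> Sup (variation_sums g b) - norm (g b - g a)" by simp
      qed
      then show ?thesis by simp
    qed simp
  qed
qed

text \<open>The majorant of one period is repeated on every unit interval, raised by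
  \<open>V\<close> each time. An increment across an integer is split at that integer, where
  \<open>g\<close> takes the value \<open>g 0\<close>.\<close>

lemma variation_majorant:
  assumes "bounded_variation g" and per: "\<And>x. g (x + 1) = g x"
  obtains T :: "real \<Rightarrow> real" and V :: real where
    "\<And>a b. a \<le> b \<Longrightarrow> norm (g b - g a) \<le> T b - T a"
    "\<And>x. T (x + 1) = T x + V"
proof -
  interpret g: periodic_fun_simple' g by standard (rule per)
  obtain U :: "real \<Rightarrow> real" where
    U: "\<And>a b. \<lbrakk>0 \<le> a; a \<le> b; b \<le> 1\<rbrakk> \<Longrightarrow> norm (g b - g a) \<le> U b - U a"
    using variation_majorant_unit_interval[OF assms(1)] by blast
  define V where "V = U 1 - U 0"
  define T where "T x = U (frac x) + of_int \<lfloor>x\<rfloor> * V" for x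
  have V: "0 \<le> V" using U[of 0 1] norm_ge_zero[of "g 1 - g 0"] by (simp add: V_def del: norm_ge_zero)
  have g_frac: "g (frac x) = g x" for x
    using g.plus_of_int[of x "- \<lfloor>x\<rfloor>"] by (simp add: frac_def)
  have f1: "frac x \<le> 1" for x :: real using frac_lt_1[of x] by linarith
  show thesis
  proof (rule that)
    fix a b :: real assume ab: "a \<le> b"
    show "norm (g b - g a) \<le> T b - T a"
    proof (cases "\<lfloor>a\<rfloor> = \<lfloor>b\<rfloor>")
      case True
      then have "frac a \<le> frac b" using ab by (simp add: frac_def)
      then show ?thesis
        using U[of "frac a" "frac b"] True by (simp add: T_def g_frac f1)
    next
      case False
      then have "\<lfloor>a\<rfloor> + 1 \<le> \<lfloor>b\<rfloor>" using floor_mono[OF ab] by linarith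
      \<comment> \<open>As \<open>V\<close> is nonnegative, whole periods between \<open>a\<close>
        and \<open>b\<close> only enlarge \<open>T b - T a\<close>, so it suffices to count the way
        from \<open>a\<close> up to the next integer and from the integer part of \<open>b\<close>
        up to \<open>b\<close>.\<close>
      then have "1 * V \<le> of_int (\<lfloor>b\<rfloor> - \<lfloor>a\<rfloor>) * V" using V by (intro mult_right_mono) linarith+
      then have "T b - T a \<ge> (U (frac b) - U 0) + (U 1 - U (frac a))"
        by (simp add: T_def V_def algebra_simps)
      moreover have "norm (g b - g 0) \<le> U (frac b) - U 0"
        using U[of 0 "frac b"] by (simp add: g_frac f1)
      moreover have "norm (g 0 - g a) \<le> U 1 - U (frac a)"
        using U[of "frac a" 1] per[of 0] by (simp add: g_frac f1)
      moreover have "norm (g b - g a) \<le> norm (g b - g 0) + norm (g 0 - g a)"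
        using norm_triangle_ineq[of "g b - g 0" "g 0 - g a"] by simp
      ultimately show ?thesis by linarith
    qed
  next
    fix x show "T (x + 1) = T x + V"
      by (simp add: T_def frac_def algebra_simps)
  qed
qed

section \<open>Equidistant points and the Denjoy-Koksma inequality\<close>

text \<open>Only the fractional part \<open>d\<close> of the shift matters. The piece over
  [0, \<open>d\<close>] is moved by one period to [1, \<open>d\<close> + 1] and glued to the piece
  over [\<open>d\<close>, 1].\<close>

lemma has_integral_periodic_shift:
  fixes g :: "real \<Rightarrow> complex"
  assumes per: "\<And>x. g (x + 1) = g x" and int: "(g has_integral I) {0..1}"
  shows "((\<lambda>u. g (u + c)) has_integral I) {0..1}"
proof -
  interpret g: periodic_fun_simple' g by standard (rule per)
  define d where "d = frac c"
  have d: "0 \<le> d" "d \<le> 1" using frac_lt_1[of c] by (auto simp: d_def)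
  have on: "g integrable_on {0..d}" "g integrable_on {d..1}"
    using int d integrable_on_subinterval[of g "{0..1}"] by (auto simp: has_integral_iff)
  have "((\<lambda>x. g (x + (-1))) has_integral integral {0..d} g) {0 - (-1)..d - (-1)}"
    by (rule has_integral_shift_real_ivl) (use on in blast)
  moreover have "g (x - 1) = g x" for x using per[of "x - 1"] by simp
  ultimately have "(g has_integral integral {0..d} g) {1..d + 1}" by (simp add: add.commute)
  then have "(g has_integral (integral {d..1} g + integral {0..d} g)) {d..d + 1}"
    using on d by (intro has_integral_combine[where c = 1]) auto
  moreover have "integral {0..d} g + integral {d..1} g = I"
    using Henstock_Kurzweil_Integration.integral_combine[OF d, of g] int by (auto simp: has_integral_iff)
  ultimately have "(g has_integral I) {d..d + 1}" by (simp add: add.commute)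
  then have "((\<lambda>u. g (u + d)) has_integral I) {d - d..d + 1 - d}"
    by (rule has_integral_shift_real_ivl)
  moreover have "g (u + d) = g (u + c)" for u
    using g.plus_of_int[of "u + c" "- \<lfloor>c\<rfloor>"] by (simp add: d_def frac_def algebra_simps)
  ultimately show ?thesis by simp
qed

text \<open>Multiplication by \<open>h\<close> is invertible modulo \<open>k\<close>, so the map is
  injective on a finite set into itself. It tells which equidistant point each orbit point is close
  to.\<close>

lemma bij_betw_mult_mod:
  fixes h m :: int and k :: nat
  assumes "coprime h (int k)" "k > 0"
  shows "bij_betw (\<lambda>n. nat ((int n * h - m) mod int k)) {..<k} {..<k}"
proof -
  have inj: "inj_on (\<lambda>n. nat ((int n * h - m) mod int k)) {..<k}"
  proof (rule inj_onI)
    fix a b :: nat assume ab: "a \<in> {..<k}" "b \<in> {..<k}"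
      and "nat ((int a * h - m) mod int k) = nat ((int b * h - m) mod int k)"
    then have "(int a * h - m) mod int k = (int b * h - m) mod int k"
      using assms(2) by (simp add: nat_eq_iff)
    then have "int k dvd (int a - int b) * h"
      by (simp add: mod_eq_dvd_iff algebra_simps)
    then have "int k dvd int a - int b"
      using assms(1) by (simp add: coprime_dvd_mult_left_iff coprime_commute)
    then show "a = b" using ab
      by (simp flip: mod_eq_dvd_iff)
  qed
  moreover have "(\<lambda>n. nat ((int n * h - m) mod int k)) ` {..<k} \<subseteq> {..<k}"
    using assms(2) by (auto simp: nat_less_iff)
  ultimately show ?thesis
    unfolding bij_betw_def by (intro conjI endo_inj_surj) simp_all
qed

text \<open>Modulo 1, the two sums run over points that can be paired so that both members of each pair lie
  in a common interval \<open>[z + (j - 1)/k, z + (j + 1)/k]\<close>, with each \<open>j < k\<close> used once.\<close>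

lemma orbit_sum_near_equidistant_sum:
  fixes g :: "real \<Rightarrow> complex" and T :: "real \<Rightarrow> real" and h :: int and k :: nat
  assumes per: "\<And>x. g (x + 1) = g x"
    and T: "\<And>a b. a \<le> b \<Longrightarrow> norm (g b - g a) \<le> T b - T a"
    and TV: "\<And>x. T (x + 1) = T x + V"
    and hk: "coprime h (int k)" "k > 0" "\<bar>real k * \<alpha> - of_int h\<bar> \<le> 1 / real k"
  shows "norm ((\<Sum>n<k. g (x + real n * \<alpha>)) - (\<Sum>j<k. g (y + real j / real k))) \<le> 2 * V"
proof -
  interpret g: periodic_fun_simple' g by standard (rule per)
  \<comment> \<open>Rounding \<open>y - x\<close> down to a multiple of 1/\<open>k\<close> gives a
    base point \<open>z\<close> with \<open>z\<close> \<le> \<open>y\<close> \<le> \<open>z\<close>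
    + 1/\<open>k\<close>. Modulo 1, the orbit point with index \<open>n\<close> is then
    \<open>z + \<rho> n / k\<close> up to the error \<open>n * (\<alpha> - h / k)\<close>.\<close>
  define m where "m = \<lfloor>real k * (y - x)\<rfloor>"
  define z where "z = x + of_int m / real k"
  define \<rho> where "\<rho> n = nat ((int n * h - m) mod int k)" for n
  have bij: "bij_betw \<rho> {..<k} {..<k}"
    unfolding \<rho>_def by (rule bij_betw_mult_mod[OF hk(1,2)])
  have "of_int m \<le> real k * (y - x)" "real k * (y - x) \<le> of_int m + 1"
    unfolding m_def by linarith+
  then have yz: "z \<le> y" "y \<le> z + 1 / real k"
    using hk(2) by (simp_all add: z_def field_simps)
  have shift: "g (x + real n * \<alpha>) = g (z + real (\<rho> n) / real k + real n * (\<alpha> - of_int h / real k))" for n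
  proof -
    have "real (\<rho> n) = of_int (int n * h - m - int k * ((int n * h - m) div int k))"
      using hk(2) unfolding \<rho>_def by (simp add: minus_mult_div_eq_mod del: of_int_diff)
    then have "real (\<rho> n) / real k = real n * of_int h / real k - of_int m / real k
        - of_int ((int n * h - m) div int k)"
      using hk(2) by (simp add: diff_divide_distrib)
    then have "x + real n * \<alpha> = (z + real (\<rho> n) / real k + real n * (\<alpha> - of_int h / real k))
        + of_int ((int n * h - m) div int k)"
      by (simp add: z_def right_diff_distrib)
    then show ?thesis using g.plus_of_int by metis
  qed
  have small: "\<bar>real n * (\<alpha> - of_int h / real k)\<bar> \<le> 1 / real k" if "n < k" for n
  proof -
    have "\<bar>real n * (\<alpha> - of_int h / real k)\<bar> = real n / real k * \<bar>real k * \<alpha> - of_int h\<bar>"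
      using hk(2) abs_mult[of "real n / real k" "real k * \<alpha> - of_int h"]
      by (simp add: right_diff_distrib)
    also have "\<dots> \<le> 1 * (1 / real k)"
      using hk(2,3) that by (intro mult_mono) auto
    finally show ?thesis by simp
  qed
  have mono: "T a \<le> T b" if "a \<le> b" for a b
    using T[OF that] norm_ge_zero[of "g b - g a"] by linarith
  have pair: "norm (g a - g b) \<le> T w - T v" if "v \<le> a" "a \<le> w" "v \<le> b" "b \<le> w" for a b v w
  proof (cases "a \<le> b")
    case True
    then show ?thesis using T[of a b] mono[OF that(1)] mono[OF that(4)] by (simp add: norm_minus_commute)
  next
    case False
    then show ?thesis using T[of b a] mono[OF that(2)] mono[OF that(3)] by simp
  qed
  \<comment> \<open>The index is shifted by one so that the increment of \<open>T\<close> over the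
    interval around \<open>z + j / k\<close> of radius 1/\<open>k\<close> is
    \<open>f (j + 2) - f j\<close>, with natural indices even for \<open>j = 0\<close>.\<close>
  define f where "f i = T (z + (real i - 1) / real k)" for i :: nat
  have f: "f (i + k) = f i + V" for i
    using TV[of "z + (real i - 1) / real k"] hk(2) by (simp add: f_def field_simps)
  have "(\<Sum>j<k. g (y + real j / real k)) = (\<Sum>n<k. g (y + real (\<rho> n) / real k))"
    using sum.reindex_bij_betw[OF bij, of "\<lambda>j. g (y + real j / real k)"] by simp
  then have "norm ((\<Sum>n<k. g (x + real n * \<alpha>)) - (\<Sum>j<k. g (y + real j / real k)))
      = norm (\<Sum>n<k. g (x + real n * \<alpha>) - g (y + real (\<rho> n) / real k))"
    by (simp add: sum_subtractf)
  also have "\<dots> \<le> (\<Sum>n<k. f (\<rho> n + 2) - f (\<rho> n))"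
  proof (rule order_trans[OF norm_sum sum_mono])
    fix n assume "n \<in> {..<k}"
    then show "norm (g (x + real n * \<alpha>) - g (y + real (\<rho> n) / real k)) \<le> f (\<rho> n + 2) - f (\<rho> n)"
      unfolding shift f_def using small[of n] yz hk(2)
      by (intro pair) (auto simp: add_divide_distrib diff_divide_distrib abs_le_iff)
  qed
  also have "\<dots> = (\<Sum>j<k. f (j + 2) - f j)"
    using sum.reindex_bij_betw[OF bij, of "\<lambda>j. f (j + 2) - f j"] .
  \<comment> \<open>The intervals overlap and cover a period twice; each of the two sums telescopes
    to the increment \<open>V\<close> of \<open>T\<close> over one period.\<close>
  also have "\<dots> = (\<Sum>j<k. f (Suc (Suc j)) - f (Suc j)) + (\<Sum>j<k. f (Suc j) - f j)"
    by (simp flip: sum.distrib)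
  also have "\<dots> = 2 * V"
    using f[of 0] f[of 1] sum_lessThan_telescope[of f k] sum_lessThan_telescope[of "\<lambda>j. f (Suc j)" k]
    by simp
  finally show ?thesis .
qed

text \<open>The comparison with equidistant points holds for every starting point \<open>u\<close>.
  Integrating it over \<open>u\<close> in [0, 1] leaves the orbit sum \<open>S\<close> unchanged and
  kills the equidistant sum, as each of its terms has integral 0.\<close>

lemma Denjoy_Koksma:
  fixes g :: "real \<Rightarrow> complex" and T :: "real \<Rightarrow> real" and h :: int and k :: nat
  assumes per: "\<And>x. g (x + 1) = g x" and int: "(g has_integral 0) {0..1}"
    and T: "\<And>a b. a \<le> b \<Longrightarrow> norm (g b - g a) \<le> T b - T a"
    and TV: "\<And>x. T (x + 1) = T x + V"
    and hk: "coprime h (int k)" "k > 0" "\<bar>real k * \<alpha> - of_int h\<bar> \<le> 1 / real k"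
  shows "norm (\<Sum>n<k. g (x + real n * \<alpha>)) \<le> 2 * V"
proof -
  define S where "S = (\<Sum>n<k. g (x + real n * \<alpha>))"
  have V: "0 \<le> V" using order_trans[OF norm_ge_zero T[of 0 1]] TV[of 0] by simp
  have "((\<lambda>u. \<Sum>j<k. g (u + real j / real k)) has_integral (\<Sum>j<k. 0)) {0..1}"
    by (intro has_integral_sum has_integral_periodic_shift[OF per int]) simp
  moreover have "((\<lambda>u. S) has_integral S) {0..1::real}"
    using has_integral_const_real[of S 0 1] by simp
  ultimately have "((\<lambda>u. S - (\<Sum>j<k. g (u + real j / real k))) has_integral (S - 0)) {0..1}"
    by (intro has_integral_diff) simp_all
  then have "norm (S - 0) \<le> 2 * V * measure lborel (cbox 0 (1::real))"
    using orbit_sum_near_equidistant_sum[where g = g and \<alpha> = \<alpha> and x = x, OF per T TV hk] V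
    by (intro has_integral_bound) (auto simp: S_def)
  then show ?thesis by (simp add: S_def)
qed

section \<open>Cutting orbits into blocks of suitable length\<close>

text \<open>The bounds must be uniform in the starting point: peeling off the first block moves it
  to \<open>x + k * \<alpha>\<close>.\<close>

lemma norm_sum_blocks_le:
  fixes g :: "real \<Rightarrow> complex" and \<alpha> :: real
  assumes block: "\<And>x. norm (\<Sum>n<k. g (x + real n * \<alpha>)) \<le> B"
    and rest: "\<And>x. norm (\<Sum>n<m. g (x + real n * \<alpha>)) \<le> R"
  shows "norm (\<Sum>n<b * k + m. g (x + real n * \<alpha>)) \<le> real b * B + R"
proof -
  have split: "(\<Sum>n<i + j. f n) = (\<Sum>n<i. f n) + (\<Sum>n<j. f (i + n))" for f :: "nat \<Rightarrow> complex" and i j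
    by (induction j) (simp_all add: algebra_simps)
  show ?thesis
  proof (induction b arbitrary: x)
    case 0
    then show ?case using rest by simp
  next
    case (Suc b)
    have "(\<Sum>n<Suc b * k + m. g (x + real n * \<alpha>))
        = (\<Sum>n<k + (b * k + m). g (x + real n * \<alpha>))"
      by (simp add: algebra_simps)
    also have "\<dots> = (\<Sum>n<k. g (x + real n * \<alpha>)) + (\<Sum>n<b * k + m. g (x + real k * \<alpha> + real n * \<alpha>))"
      using split[of _ k "b * k + m"] by (simp add: algebra_simps)
    finally show ?case
      using block[of x] Suc.IH[of "x + real k * \<alpha>"]
        norm_triangle_ineq[of "\<Sum>n<k. g (x + real n * \<alpha>)" "\<Sum>n<b * k + m. g (x + real k * \<alpha> + real n * \<alpha>)"]
      by (simp add: algebra_simps)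
  qed
qed

text \<open>The bound on \<open>N / k\<close> is what limits the number of blocks. Dirichlet's error
  is below 1/\<open>N\<close>, hence at most 1/\<open>k\<close>, which is all that the Denjoy-Koksma
  inequality requires.\<close>

lemma diophantine_denominator:
  assumes r: "r > 1" and dioph: "diophantine_of_type r \<alpha>"
  obtains A where "A > 0"
    "\<And>N. N \<ge> 1 \<Longrightarrow> \<exists>(h::int) (k::nat). coprime h (int k) \<and> 0 < k \<and> k \<le> N
        \<and> \<bar>real k * \<alpha> - of_int h\<bar> \<le> 1 / real k \<and> real N / real k \<le> A * real N powr (1 - 1 / r)"
proof -
  obtain C where C: "C > 0"
    and dio: "\<And>(p::int) (q::nat). q \<ge> 1 \<Longrightarrow> \<bar>\<alpha> - of_int p / real q\<bar> \<ge> C / real q powr (1 + r)"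
    using dioph by (auto simp: diophantine_of_type_def)
  show thesis
  \<comment> \<open>The constant comes from \<open>C * N\<close> \<le> \<open>k powr r\<close>: then
    \<open>k\<close> is at least \<open>(C * N) powr (1 / r)\<close>, and dividing \<open>N\<close>
    by this leaves \<open>C powr (- 1 / r) * N powr (1 - 1 / r)\<close>.\<close>
  proof (rule that[of "C powr (- 1 / r)"])
    show "C powr (- 1 / r) > 0" using C by simp
    fix N :: nat assume N: "N \<ge> 1"
    obtain h k where hk: "coprime h k" "0 < k" "k \<le> int N" "\<bar>of_int k * \<alpha> - of_int h\<bar> < 1 / real N"
      using Dirichlet_approx_coprime[of N \<alpha>] N by auto
    define q where "q = nat k"
    have q: "coprime h (int q)" "0 < q" "q \<le> N" "\<bar>real q * \<alpha> - of_int h\<bar> < 1 / real N"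
      using hk by (auto simp: q_def)
    have "1 / real N \<le> 1 / real q" using q by (simp add: field_simps)
    have "C / real q powr r = real q * (C / real q powr (1 + r))"
      using q by (simp add: powr_add)
    also have "\<dots> \<le> real q * \<bar>\<alpha> - of_int h / real q\<bar>"
      using dio[of q h] q by (intro mult_left_mono) auto
    also have "\<dots> = \<bar>real q * \<alpha> - of_int h\<bar>"
      using q abs_mult[of "real q" "\<alpha> - of_int h / real q"] by (simp add: right_diff_distrib)
    also have "\<dots> < 1 / real N" by (rule q(4))
    finally have "C * real N \<le> real q powr r" using q N by (simp add: field_simps)
    then have "(C * real N) powr (1 / r) \<le> (real q powr r) powr (1 / r)"
      using C r by (intro powr_mono2) auto
    also have "\<dots> = real q" using r q by (simp add: powr_powr)
    finally have le: "C powr (1 / r) * real N powr (1 / r) \<le> real q"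
      using C by (simp add: powr_mult)
    have "real N = real N powr (1 / r) * real N powr (1 - 1 / r)"
      using N by (simp flip: powr_add)
    also have "\<dots> = C powr (- 1 / r) * ((C powr (1 / r) * real N powr (1 / r)) * real N powr (1 - 1 / r))"
      using C by (simp add: powr_minus field_simps)
    also have "\<dots> \<le> C powr (- 1 / r) * (real q * real N powr (1 - 1 / r))"
      using le by (intro mult_left_mono mult_right_mono) auto
    finally have "real N / real q \<le> C powr (- 1 / r) * real N powr (1 - 1 / r)"
      using q by (simp add: field_simps)
    then show "\<exists>(h::int) (k::nat). coprime h (int k) \<and> 0 < k \<and> k \<le> N
        \<and> \<bar>real k * \<alpha> - of_int h\<bar> \<le> 1 / real k \<and> real N / real k \<le> C powr (- 1 / r) * real N powr (1 - 1 / r)"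
      using q \<open>1 / real N \<le> 1 / real q\<close> by (intro exI[of _ h] exI[of _ q]) auto
  qed
qed

text \<open>The quotient is at least 1, so \<open>N\<close> contains a full \<open>k\<close> besides
  the remainder, which is smaller than \<open>k\<close>. The factor 1/2 makes the later induction
  contract.\<close>

lemma mod_le_half:
  fixes N k :: nat
  assumes "0 < k" "k \<le> N"
  shows "real (N mod k) \<le> real N / 2"
proof -
  have "1 * k \<le> N div k * k"
    using assms by (intro mult_right_mono) (auto simp: Suc_le_eq div_greater_zero_iff)
  moreover have "N mod k < k" using assms by simp
  ultimately have "2 * (N mod k) \<le> N" using div_mult_mod_eq[of N k] by linarith
  then show ?thesis by linarith
qed

section \<open>Abel summation and the abscissa of convergence\<close>

text \<open>After summation by parts the terms are of order
  \<open>n powr (\<beta> - Re s - 1)\<close>, with exponent below -1, and the boundary term is of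
  order \<open>N powr (\<beta> - Re s)\<close>, which tends to 0.\<close>

lemma summable_dirichlet_of_partial_sums:
  fixes b :: "nat \<Rightarrow> complex" and s :: complex
  assumes S: "\<And>N. norm (\<Sum>n<N. b n) \<le> K * real N powr \<beta>" and \<beta>: "0 \<le> \<beta>" "\<beta> < Re s"
  shows "summable (\<lambda>n. b n / of_nat (Suc n) powr s)"
proof -
  define A where "A N = (\<Sum>n<N. b n)" for N
  define c where "c n = (of_nat (Suc n) :: complex) powr (- s)" for n
  have parts: "(\<Sum>n<N. b n * c n) = A N * c N + (\<Sum>n<N. A (Suc n) * (c n - c (Suc n)))" for N
  proof (induction N)
    case (Suc N)
    have "A (Suc N) = A N + b N" by (simp add: A_def)
    then show ?case using Suc by (simp add: algebra_simps)
  qed (simp add: A_def)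
  have K: "0 \<le> K" using order_trans[OF norm_ge_zero S[of 1]] by simp
  \<comment> \<open>Mean value inequality on the segment between consecutive integers. It consists
    of positive reals, so the power is differentiable there and its norm is a decreasing real
    power.\<close>
  have diff: "norm (c n - c (Suc n)) \<le> norm s * real (Suc n) powr (- Re s - 1)" for n
  proof -
    let ?I = "closed_segment (of_nat (Suc n) :: complex) (of_nat (Suc (Suc n)))"
    have I: "\<exists>t. z = complex_of_real t \<and> real (Suc n) \<le> t" if z: "z \<in> ?I" for z
    proof -
      obtain u where u: "0 \<le> u" "u \<le> 1"
        and "z = (1 - u) *\<^sub>R of_nat (Suc n) + u *\<^sub>R of_nat (Suc (Suc n))"
        using z unfolding closed_segment_def by blast
      then have "z = complex_of_real (real (Suc n) + u)"
        by (simp add: scaleR_conv_of_real algebra_simps)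
      then show ?thesis using u(1) by (intro exI[of _ "real (Suc n) + u"]) simp
    qed
    have "norm (c n - c (Suc n)) \<le> norm s * real (Suc n) powr (- Re s - 1)
        * norm (of_nat (Suc n) - of_nat (Suc (Suc n)) :: complex)"
      unfolding c_def
    proof (rule field_differentiable_bound[where S = ?I and f' = "\<lambda>z. - s * z powr (- s - 1)"])
      fix z assume "z \<in> ?I"
      then obtain t where t: "z = complex_of_real t" "real (Suc n) \<le> t" using I by blast
      show "((\<lambda>z. z powr - s) has_field_derivative - s * z powr (- s - 1)) (at z within ?I)"
        by (rule has_field_derivative_at_within[OF has_field_derivative_powr])
           (use t in \<open>auto simp: complex_nonpos_Reals_iff\<close>)
      have "norm (z powr (- s - 1)) = t powr (- Re s - 1)"
        using t by (simp add: norm_powr_real_powr)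
      also have "\<dots> \<le> real (Suc n) powr (- Re s - 1)"
        using t(2) \<beta> by (intro powr_mono2') auto
      finally show "norm (- s * z powr (- s - 1)) \<le> norm s * real (Suc n) powr (- Re s - 1)"
        by (simp add: norm_mult mult_left_mono)
    qed auto
    then show ?thesis by simp
  qed
  have "summable (\<lambda>n. real (Suc n) powr (\<beta> - Re s - 1))"
    using summable_real_powr_iff[of "\<beta> - Re s - 1"] \<beta> by (subst summable_Suc_iff) simp
  then have "summable (\<lambda>n. K * norm s * real (Suc n) powr (\<beta> - Re s - 1))"
    by (rule summable_mult)
  then have "summable (\<lambda>n. A (Suc n) * (c n - c (Suc n)))"
  proof (rule summable_comparison_test'[where N = 0])
    fix n
    have "norm (A (Suc n) * (c n - c (Suc n)))
        \<le> (K * real (Suc n) powr \<beta>) * (norm s * real (Suc n) powr (- Re s - 1))"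
      unfolding norm_mult A_def using K by (intro mult_mono S diff) auto
    also have "\<dots> = K * norm s * real (Suc n) powr (\<beta> - Re s - 1)"
      using powr_add[of "real (Suc n)" \<beta> "- Re s - 1"] by (simp add: algebra_simps)
    finally show "norm (A (Suc n) * (c n - c (Suc n))) \<le> K * norm s * real (Suc n) powr (\<beta> - Re s - 1)" .
  qed
  then obtain L where L: "(\<lambda>N. \<Sum>n<N. A (Suc n) * (c n - c (Suc n))) \<longlonglongrightarrow> L"
    by (auto simp: summable_def sums_def)
  have "(\<lambda>N. A N * c N) \<longlonglongrightarrow> 0"
  proof (rule Lim_null_comparison)
    show "\<forall>\<^sub>F N in sequentially. norm (A N * c N) \<le> K * real (Suc N) powr (- (Re s - \<beta>))"
    proof (intro always_eventually allI)
      fix N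
      have "norm (A N * c N) \<le> (K * real (Suc N) powr \<beta>) * real (Suc N) powr (- Re s)"
        unfolding norm_mult
      proof (intro mult_mono)
        have "norm (A N) \<le> K * real N powr \<beta>" unfolding A_def by (rule S)
        also have "\<dots> \<le> K * real (Suc N) powr \<beta>"
          using K \<beta> by (intro mult_left_mono powr_mono2) auto
        finally show "norm (A N) \<le> K * real (Suc N) powr \<beta>" .
        show "norm (c N) \<le> real (Suc N) powr (- Re s)"
          unfolding c_def by (subst norm_powr_real_powr) auto
      qed (use K in auto)
      also have "\<dots> = K * real (Suc N) powr (- (Re s - \<beta>))"
        using powr_add[of "real (Suc N)" \<beta> "- Re s"] by (simp add: algebra_simps)
      finally show "norm (A N * c N) \<le> K * real (Suc N) powr (- (Re s - \<beta>))" .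
    qed
    have "(\<lambda>N. real (Suc N) powr (- (Re s - \<beta>))) \<longlonglongrightarrow> 0"
      using \<beta> by (intro LIMSEQ_Suc[of "\<lambda>N. real N powr _"] tendsto_neg_powr filterlim_real_sequentially) auto
    then show "(\<lambda>N. K * real (Suc N) powr (- (Re s - \<beta>))) \<longlonglongrightarrow> 0"
      by (rule tendsto_mult_right_zero)
  qed
  then have "(\<lambda>N. \<Sum>n<N. b n * c n) \<longlonglongrightarrow> 0 + L"
    unfolding parts using L by (rule tendsto_add)
  then have "summable (\<lambda>n. b n * c n)" by (auto simp: summable_def sums_def)
  then show ?thesis by (simp add: c_def powr_minus field_simps)
qed

text \<open>Convergence at \<open>s\<close> bounds the partial sums, so Abel summation with exponent
  \<open>\<beta> = 0\<close> applies to the remaining factor with exponent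
  \<open>s' - s\<close>.\<close>

lemma dirichlet_converges_mono:
  assumes "dirichlet_converges a s" "Re s < Re s'"
  shows "dirichlet_converges a s'"
proof -
  define b where "b n = a (Suc n) / of_nat (Suc n) powr s" for n
  have "summable b" using assms(1) by (simp add: dirichlet_converges_def b_def[abs_def])
  then have "convergent (\<lambda>N. \<Sum>n<N. b n)" by (simp add: summable_iff_convergent)
  then obtain K where K: "\<And>N. norm (\<Sum>n<N. b n) \<le> K"
    using convergent_imp_Bseq Bseq_def by metis
  \<comment> \<open>Since \<open>0 powr 0 = 0\<close>, the bound for \<open>N = 0\<close> is 0 and
    is met only because the sum is empty.\<close>
  have "norm (\<Sum>n<N. b n) \<le> K * real N powr 0" for N
    using K[of N] by (cases "N = 0") auto
  then have "summable (\<lambda>n. b n / of_nat (Suc n) powr (s' - s))"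
    by (rule summable_dirichlet_of_partial_sums) (use assms(2) in auto)
  moreover have "b n / of_nat (Suc n) powr (s' - s) = a (Suc n) / of_nat (Suc n) powr s'" for n
    by (simp add: b_def powr_diff del: of_nat_Suc)
  ultimately show ?thesis by (simp add: dirichlet_converges_def)
qed

text \<open>The abscissa is the infimum of the real parts of all points of convergence, taken in
  \<open>ereal\<close> so that infinite values are covered. Monotonicity gives convergence to its
  right.\<close>

lemma ex_abscissa_of_convergence_le:
  assumes "\<And>s. Re s > \<beta> \<Longrightarrow> dirichlet_converges a s"
  shows "\<exists>\<sigma>\<^sub>0. is_abscissa_of_convergence a \<sigma>\<^sub>0 \<and> \<sigma>\<^sub>0 \<le> ereal \<beta>"
proof -
  define \<sigma> where "\<sigma> = Inf {ereal (Re s) | s. dirichlet_converges a s}"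
  have "dirichlet_converges a s" if "ereal (Re s) > \<sigma>" for s
    using that dirichlet_converges_mono by (auto simp: \<sigma>_def Inf_less_iff)
  moreover have "\<not> dirichlet_converges a s" if "ereal (Re s) < \<sigma>" for s
    using that by (auto simp: \<sigma>_def not_le[symmetric] intro: Inf_lower)
  moreover have "\<sigma> \<le> ereal \<beta>"
  proof (rule ereal_le_epsilon2)
    fix e :: real assume "0 < e"
    then have "dirichlet_converges a (of_real (\<beta> + e))" using assms by simp
    then show "\<sigma> \<le> ereal \<beta> + ereal e"
      unfolding \<sigma>_def by (intro Inf_lower CollectI exI[of _ "of_real (\<beta> + e)"]) auto
  qed
  ultimately show ?thesis unfolding is_abscissa_of_convergence_def by blast
qed

section \<open>Growth of orbit sums and the conclusion\<close>

lemma orbit_sum_bound: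
  fixes g :: "real \<Rightarrow> complex"
  assumes r: "r > 1" and dioph: "diophantine_of_type r \<alpha>"
    and per: "\<And>x. g (x + 1) = g x"
    and bv: "bounded_variation g" and int: "(g has_integral 0) {0..1}"
  obtains K where "\<And>N x. norm (\<Sum>n<N. g (x + real n * \<alpha>)) \<le> K * real N powr (1 - 1 / r)"
proof -
  obtain T :: "real \<Rightarrow> real" and V :: real where
    T: "\<And>a b. a \<le> b \<Longrightarrow> norm (g b - g a) \<le> T b - T a"
    and TV: "\<And>x. T (x + 1) = T x + V"
    using variation_majorant[OF bv per] by blast
  obtain A where A: "A > 0"
    and approx: "\<And>N. N \<ge> 1 \<Longrightarrow> \<exists>(h::int) (k::nat). coprime h (int k) \<and> 0 < k \<and> k \<le> N
      \<and> \<bar>real k * \<alpha> - of_int h\<bar> \<le> 1 / real k \<and> real N / real k \<le> A * real N powr (1 - 1 / r)"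
    using diophantine_denominator[OF r dioph] by blast
  define \<beta> where "\<beta> = 1 - 1 / r"
  have \<beta>: "0 < \<beta>" using r by (simp add: \<beta>_def)
  have V: "0 \<le> V" using order_trans[OF norm_ge_zero T[of 0 1]] TV[of 0] by simp
  define c :: real where "c = (1 / 2) powr \<beta>"
  have c: "c < 1" using powr_less_mono2[of \<beta> "1 / 2" 1] \<beta> by (simp add: c_def)
  \<comment> \<open>\<open>K\<close> solves \<open>K = 2 * V * A + K * c\<close>: the full blocks
    contribute at most \<open>2 * V * A * N powr \<beta>\<close>, and the remainder, of length at
    most \<open>N / 2\<close>, at most \<open>K * c * N powr \<beta>\<close>. Here
    \<open>c < 1\<close> because \<open>\<beta> > 0\<close>.\<close>
  define K where "K = 2 * V * A / (1 - c)"
  have K: "0 \<le> K" "2 * V * A + K * c = K"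
    using V A c by (auto simp: K_def field_simps)
  have "norm (\<Sum>n<N. g (x + real n * \<alpha>)) \<le> K * real N powr \<beta>" for N x
  proof (induction N arbitrary: x rule: less_induct)
    case (less N)
    show ?case
    proof (cases "N = 0")
      case False
      then obtain h k where hk: "coprime h (int k)" "0 < k" "\<bar>real k * \<alpha> - of_int h\<bar> \<le> 1 / real k"
        and k: "k \<le> N" "real N / real k \<le> A * real N powr \<beta>"
        using approx[of N] by (auto simp: \<beta>_def)
      have "N mod k < N" using hk(2) k(1) mod_less_divisor[of k N] by linarith
      then have "norm (\<Sum>n<N div k * k + N mod k. g (x + real n * \<alpha>))
          \<le> real (N div k) * (2 * V) + K * real (N mod k) powr \<beta>"
        by (intro norm_sum_blocks_le Denjoy_Koksma[where g = g, OF per int T TV hk] less.IH)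
      also have "\<dots> \<le> (A * real N powr \<beta>) * (2 * V) + K * (real N / 2) powr \<beta>"
      proof (intro add_mono mult_right_mono mult_left_mono powr_mono2)
        show "real (N div k) \<le> A * real N powr \<beta>"
          using of_nat_div_le_of_nat[of N k, where ?'a = real] k(2) by linarith
      qed (use V K \<beta> mod_le_half[OF hk(2) k(1)] in auto)
      also have "(real N / 2) powr \<beta> = c * real N powr \<beta>"
        using powr_mult[of "1 / 2" "real N" \<beta>] by (simp add: c_def)
      also have "(A * real N powr \<beta>) * (2 * V) + K * (c * real N powr \<beta>)
          = (2 * V * A + K * c) * real N powr \<beta>"
        by (simp add: algebra_simps)
      finally show ?thesis by (simp add: K(2))
    qed simp
  qed
  then show thesis using that[of K] by (simp add: \<beta>_def)
qed

theorem proposition6: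
  fixes r \<alpha> :: real and g :: "real \<Rightarrow> complex"
  assumes "r > 1"
    and "diophantine_of_type r \<alpha>"
    and "\<And>x. g (x + 1) = g x"
    and "bounded_variation g"
    and "(g has_integral 0) {0..1}"
  shows "\<exists>\<sigma>\<^sub>0 :: ereal. is_abscissa_of_convergence (zeta_coeff g \<alpha>) \<sigma>\<^sub>0 \<and> \<sigma>\<^sub>0 \<le> ereal (1 - 1 / r)"
proof (rule ex_abscissa_of_convergence_le)
  fix s :: complex
  assume s: "Re s > 1 - 1 / r"
  obtain K where "\<And>N x. norm (\<Sum>n<N. g (x + real n * \<alpha>)) \<le> K * real N powr (1 - 1 / r)"
    using orbit_sum_bound[OF assms] by blast
  \<comment> \<open>Starting the orbit at \<open>\<alpha>\<close> instead of 0 accounts for the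
    Dirichlet series beginning with the coefficient of index 1.\<close>
  from this[of \<alpha>] have "norm (\<Sum>n<N. zeta_coeff g \<alpha> (Suc n)) \<le> K * real N powr (1 - 1 / r)" for N
    by (simp add: zeta_coeff_def algebra_simps)
  then show "dirichlet_converges (zeta_coeff g \<alpha>) s"
    unfolding dirichlet_converges_def
    by (rule summable_dirichlet_of_partial_sums) (use s assms(1) in auto)
qed

end
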